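(* For $i=1,2$ let $(\mathcal{X}_i,\mathcal{A}_i,\mathcal{P}_i)$ be a statistical model with $\mathcal{P}_i=\{P_{\theta_i},\ \theta_i\in\Theta_i\}$. Let $(\mathcal{X},\mathcal{A},\mathcal{P})=(\mathcal{X}_1\times\mathcal{X}_2,\ \mathcal{A}_1\otimes\mathcal{A}_2,\ \mathcal{P}_1\times\mathcal{P}_2)$ be the combined statistical model, where $\mathcal{P}=\{P_\theta=P_{\theta_1}\times P_{\theta_2}\}$ is the family of product measures parameterized by $\theta=(\theta_1,\theta_2)\in\Theta=\Theta_1\times\Theta_2$. If $\widehat{\mathcal{A}}_i\subset\mathcal{A}_i$ is an MVE-algebra in the model $(\mathcal{X}_i,\mathcal{A}_i,\mathcal{P}_i)$ for $i=1,2$, then $\widehat{\mathcal{A}}=\widehat{\mathcal{A}}_1\otimes\widehat{\mathcal{A}}_2$ is an MVE-algebra in the model $(\mathcal{X},\mathcal{A},\mathcal{P})$.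
   Context: A statistical model $(\mathcal{X},\mathcal{A},\mathcal{P})$ consists of a measurable space $(\mathcal{X},\mathcal{A})$ and a family $\mathcal{P}=\{P_\theta,\ \theta\in\Theta\}$ of probability measures on it, indexed by an arbitrary parameter set $\Theta$; $X$ denotes a random element of $(\mathcal{X},\mathcal{A})$ with distribution $P_\theta$, and $E_\theta$, $\mathrm{Var}_\theta$ denote expectation and variance under $P_\theta$. A statistic is a real-valued $\mathcal{A}$-measurable function of $X$; it has finite second moment if $E_\theta|\widehat g(X)|^2<\infty$ for all $\theta\in\Theta$. A statistic $\widehat g(X)$ with finite second moment is called a UMVUE (uniformly minimum variance unbiased estimator, of $g(\theta)=E_\theta\widehat g(X)$) if $\mathrm{Var}_\theta(\widehat g(X))\le \mathrm{Var}_\theta(\widetilde g(X))$ for all $\theta\in\Theta$, for every statistic $\widetilde g(X)$ with finite second moment satisfying $E_\theta\widetilde g(X)=E_\theta\widehat g(X)$ for all $\theta\in\Theta$. A subalgebra means a sub-$\sigma$-algebra of $\mathcal{A}$. A subalgebra $\widehat{\mathcal{A}}\subset\mathcal{A}$ is an MVE-algebra in the model if every $\widehat{\mathcal{A}}$-measurable statistic with finite second moment is a UMVUE. The symbol $\otimes$ denotes the product $\sigma$-algebra. The families $\mathcal{P}_1$ and $\mathcal{P}_2$ are unrelated families, on $\mathcal{X}_1$ and $\mathcal{X}_2$ respectively, and the parameters $\theta_1,\theta_2$ vary independently. *)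

theory Defs
  imports "HOL-Probability.Probability"
begin

text \<open>
  A measurable space is represented by a value \<open>A :: 'x measure\<close> of which only
  \<open>space A\<close> and \<open>sets A\<close> matter; the same holds for a sub-sigma-algebra \<open>F\<close> of \<open>A\<close>,
  for which the library predicate \<^const>\<open>subalgebra\<close> is used. The parameter set \<open>\<Theta>\<close>
  may be empty, and \<open>P\<close> is unconstrained outside \<open>\<Theta>\<close>.
\<close>

definition statistical_model ::
    "'x measure \<Rightarrow> 't set \<Rightarrow> ('t \<Rightarrow> 'x measure) \<Rightarrow> bool" where
  "statistical_model A \<Theta> P \<longleftrightarrow> (\<forall>\<theta>\<in>\<Theta>. prob_space (P \<theta>) \<and> sets (P \<theta>) = sets A)"

text \<open>
  Since \<open>g\<close> is measurable and its square is nonnegative, integrability of the square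
  says exactly that the second moment is finite; under a probability measure it makes
  \<open>g\<close> itself integrable, so the expectations and variances below are the genuine ones.
\<close>

definition L2_statistic ::
    "'x measure \<Rightarrow> 't set \<Rightarrow> ('t \<Rightarrow> 'x measure) \<Rightarrow> ('x \<Rightarrow> real) \<Rightarrow> bool" where
  "L2_statistic A \<Theta> P g \<longleftrightarrow>
     g \<in> borel_measurable A \<and> (\<forall>\<theta>\<in>\<Theta>. integrable (P \<theta>) (\<lambda>x. \<bar>g x\<bar>\<^sup>2))"

definition UMVUE ::
    "'x measure \<Rightarrow> 't set \<Rightarrow> ('t \<Rightarrow> 'x measure) \<Rightarrow> ('x \<Rightarrow> real) \<Rightarrow> bool" where
  "UMVUE A \<Theta> P g \<longleftrightarrow>
     L2_statistic A \<Theta> P g \<and>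
     (\<forall>h. L2_statistic A \<Theta> P h \<and>
          (\<forall>\<theta>\<in>\<Theta>. prob_space.expectation (P \<theta>) h = prob_space.expectation (P \<theta>) g) \<longrightarrow>
          (\<forall>\<theta>\<in>\<Theta>. prob_space.variance (P \<theta>) g \<le> prob_space.variance (P \<theta>) h))"

definition MVE_algebra ::
    "'x measure \<Rightarrow> 't set \<Rightarrow> ('t \<Rightarrow> 'x measure) \<Rightarrow> 'x measure \<Rightarrow> bool" where
  "MVE_algebra A \<Theta> P F \<longleftrightarrow>
     subalgebra A F \<and>
     (\<forall>g. g \<in> borel_measurable F \<and> L2_statistic A \<Theta> P g \<longrightarrow> UMVUE A \<Theta> P g)"

lemma statistical_model_pair:
  assumes "statistical_model A1 \<Theta>1 P1" "statistical_model A2 \<Theta>2 P2"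
  shows "statistical_model (A1 \<Otimes>\<^sub>M A2) (\<Theta>1 \<times> \<Theta>2) (\<lambda>(\<theta>1, \<theta>2). P1 \<theta>1 \<Otimes>\<^sub>M P2 \<theta>2)"
  using assms unfolding statistical_model_def
  by (auto intro!: prob_space_pair sets_pair_measure_cong)

end

theory Submission
  imports Defs
begin

text \<open>
  Call a statistic with finite second moment whose expectation vanishes under every
  parameter an unbiased estimator of zero. The classical criterion of Lehmann and Scheffe
  says that a statistic is a UMVUE exactly if it is orthogonal, under every parameter, to
  all unbiased estimators of zero (\<open>UMVUE_iff_orthogonal\<close>). Applied to indicators in one
  direction and to conditional expectations in the other, it turns the MVE property into
  one about sets: \<open>F\<close> is an MVE-algebra iff every unbiased estimator of zero has integral
  zero over every set of \<open>F\<close> (\<open>MVE_algebra_iff_integral_zero\<close>). For a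
  product sigma-algebra such a condition need only be verified on rectangles
  (\<open>integral_zero_from_rectangles\<close>).

  Another reading of the condition is that the unbiased estimators of zero are
  closed under multiplication by indicators of sets in \<open>F\<close>. In the product model, let \<open>h\<close>
  be an unbiased estimator of zero, and freeze \<open>\<theta>\<^sub>2\<close>. Integrating out the second coordinate
  under \<open>\<theta>\<^sub>2\<close> gives an unbiased estimator of zero in the first model, because the
  hypothesis on \<open>h\<close> holds for all \<open>\<theta>\<^sub>1\<close> with this same \<open>\<theta>\<^sub>2\<close>; here the independent variation of the
  parameters enters. The MVE property in the first factor and Fubini then show
  that multiplying \<open>h\<close> by the indicator of a cylinder over \<open>B\<^sub>1 \<in> F\<^sub>1\<close> gives again an unbiased
  estimator of zero (\<open>unbiased_zero_times_cylinder\<close>). By the symmetry of the two factors the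
  product can be multiplied once more, by the indicator of a cylinder over \<open>B\<^sub>2 \<in> F\<^sub>2\<close>, and so
  the integral of \<open>h\<close> over \<open>B\<^sub>1 \<times> B\<^sub>2\<close> vanishes.
\<close>

section \<open>Quadratic polynomials and square integrable functions\<close>

lemma quadratic_nonneg_imp_linear_coeff_zero:
  fixes c d :: real
  assumes nonneg: "\<And>t. 0 \<le> 2 * t * c + t\<^sup>2 * d"
  shows "c = 0"
proof (rule ccontr)
  assume "c \<noteq> 0"
  \<comment> \<open>For \<open>d > 0\<close> the minimum is at \<open>t = - c / d\<close>; a larger, positive denominator works for every sign of \<open>d\<close>.\<close>
  define e where "e = \<bar>d\<bar> + 1"
  have e: "e > 0" "d < e" by (auto simp: e_def)
  have "0 \<le> 2 * (- c / e) * c + (- c / e)\<^sup>2 * d" by (rule nonneg)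
  also have "\<dots> = c\<^sup>2 * (d / e - 2) / e"
    using e by (simp add: field_simps power2_eq_square)
  also have "\<dots> < 0"
    using e \<open>c \<noteq> 0\<close> by (intro divide_neg_pos mult_pos_neg) (auto simp: field_simps)
  finally show False by simp
qed

lemma integrable_mult_of_square_integrable:
  fixes f g :: "'a \<Rightarrow> real"
  assumes [measurable]: "f \<in> borel_measurable M" "g \<in> borel_measurable M"
    and f: "integrable M (\<lambda>x. (f x)\<^sup>2)" and g: "integrable M (\<lambda>x. (g x)\<^sup>2)"
  shows "integrable M (\<lambda>x. f x * g x)"
proof (rule Bochner_Integration.integrable_bound)
  show "integrable M (\<lambda>x. (f x)\<^sup>2 + (g x)\<^sup>2)"
    using f g by simp
  show "AE x in M. norm (f x * g x) \<le> norm ((f x)\<^sup>2 + (g x)\<^sup>2)"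
  proof (rule AE_I2)
    fix x
    have "2 * \<bar>f x * g x\<bar> \<le> (f x)\<^sup>2 + (g x)\<^sup>2"
      using sum_squares_bound[of "\<bar>f x\<bar>" "\<bar>g x\<bar>"] by (simp add: abs_mult)
    then show "norm (f x * g x) \<le> norm ((f x)\<^sup>2 + (g x)\<^sup>2)"
      unfolding real_norm_def by linarith
  qed
qed measurable

section \<open>Unbiased estimators of zero\<close>

definition unbiased_zero ::
    "'x measure \<Rightarrow> 't set \<Rightarrow> ('t \<Rightarrow> 'x measure) \<Rightarrow> ('x \<Rightarrow> real) \<Rightarrow> bool" where
  "unbiased_zero A \<Theta> P h \<longleftrightarrow> L2_statistic A \<Theta> P h \<and> (\<forall>\<theta>\<in>\<Theta>. integral\<^sup>L (P \<theta>) h = 0)"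

lemma L2_statisticD:
  assumes "statistical_model A \<Theta> P" "L2_statistic A \<Theta> P g" "\<theta> \<in> \<Theta>"
  shows "g \<in> borel_measurable (P \<theta>)" "integrable (P \<theta>) (\<lambda>x. (g x)\<^sup>2)" "integrable (P \<theta>) g"
proof -
  interpret prob_space "P \<theta>"
    using assms by (auto simp: statistical_model_def)
  show g: "g \<in> borel_measurable (P \<theta>)"
    using assms by (auto simp: statistical_model_def L2_statistic_def cong: measurable_cong_sets)
  show "integrable (P \<theta>) (\<lambda>x. (g x)\<^sup>2)"
    using assms by (auto simp: L2_statistic_def)
  then show "integrable (P \<theta>) g"
    using g by (rule square_integrable_imp_integrable[rotated])
qed

lemma L2_statistic_add_scaled:
  assumes model: "statistical_model A \<Theta> P"
    and g: "L2_statistic A \<Theta> P g" and h: "L2_statistic A \<Theta> P h"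
  shows "L2_statistic A \<Theta> P (\<lambda>x. g x + t * h x)"
  unfolding L2_statistic_def
proof (intro conjI ballI)
  show "(\<lambda>x. g x + t * h x) \<in> borel_measurable A"
    using g h by (auto simp: L2_statistic_def)
  fix \<theta> assume \<theta>: "\<theta> \<in> \<Theta>"
  note g' = L2_statisticD[OF model g \<theta>] and h' = L2_statisticD[OF model h \<theta>]
  have "integrable (P \<theta>) (\<lambda>x. (g x)\<^sup>2 + 2 * t * (g x * h x) + t\<^sup>2 * (h x)\<^sup>2)"
    using g' h' by (intro Bochner_Integration.integrable_add integrable_mult_right
        integrable_mult_of_square_integrable) auto
  then show "integrable (P \<theta>) (\<lambda>x. \<bar>g x + t * h x\<bar>\<^sup>2)"
    by (simp add: power2_sum power_mult_distrib algebra_simps)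
qed

lemma L2_statistic_indicator:
  assumes model: "statistical_model A \<Theta> P" and B: "B \<in> sets A"
  shows "L2_statistic A \<Theta> P (indicator B)"
proof -
  have "integrable (P \<theta>) (indicator B :: _ \<Rightarrow> real)" if "\<theta> \<in> \<Theta>" for \<theta>
  proof -
    interpret prob_space "P \<theta>"
      using model that by (auto simp: statistical_model_def)
    show ?thesis
      using model that B
      by (intro integrable_real_indicator) (auto simp: statistical_model_def less_top[symmetric])
  qed
  moreover have "(\<lambda>x. \<bar>indicator B x :: real\<bar>\<^sup>2) = indicator B"
    by (auto simp: indicator_def)
  ultimately show ?thesis
    using B by (simp add: L2_statistic_def)
qed

lemma L2_statistic_indicator_mult:
  assumes model: "statistical_model A \<Theta> P" and B: "B \<in> sets A" and h: "L2_statistic A \<Theta> P h"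
  shows "L2_statistic A \<Theta> P (\<lambda>x. indicator B x * h x)"
proof -
  have "integrable (P \<theta>) (\<lambda>x. \<bar>indicator B x * h x\<bar>\<^sup>2)" if \<theta>: "\<theta> \<in> \<Theta>" for \<theta>
  proof -
    have "B \<in> sets (P \<theta>)"
      using model B \<theta> by (auto simp: statistical_model_def)
    from integrable_mult_indicator[OF this L2_statisticD(2)[OF model h \<theta>]]
    show ?thesis
      by (rule Bochner_Integration.integrable_cong[THEN iffD1, rotated -1])
        (auto simp: indicator_def)
  qed
  then show ?thesis
    using B h by (auto simp: L2_statistic_def)
qed

lemma variance_add_scaled_unbiased_zero:
  assumes model: "statistical_model A \<Theta> P"
    and g: "L2_statistic A \<Theta> P g" and h: "unbiased_zero A \<Theta> P h" and \<theta>: "\<theta> \<in> \<Theta>"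
  shows "prob_space.variance (P \<theta>) (\<lambda>x. g x + t * h x) =
    prob_space.variance (P \<theta>) g + 2 * t * (\<integral>x. g x * h x \<partial>P \<theta>) + t\<^sup>2 * (\<integral>x. (h x)\<^sup>2 \<partial>P \<theta>)"
proof -
  interpret prob_space "P \<theta>"
    using model \<theta> by (auto simp: statistical_model_def)
  have hL: "L2_statistic A \<Theta> P h" and h0: "expectation h = 0"
    using h \<theta> by (auto simp: unbiased_zero_def)
  note g' = L2_statisticD[OF model g \<theta>] and h' = L2_statisticD[OF model hL \<theta>]
  note s' = L2_statisticD[OF model L2_statistic_add_scaled[OF model g hL, of t] \<theta>]
  have gh: "integrable (P \<theta>) (\<lambda>x. g x * h x)"
    using g' h' by (intro integrable_mult_of_square_integrable) auto
  have "expectation (\<lambda>x. (g x + t * h x)\<^sup>2) =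
      expectation (\<lambda>x. (g x)\<^sup>2 + 2 * t * (g x * h x) + t\<^sup>2 * (h x)\<^sup>2)"
    by (intro arg_cong[where f = expectation] ext)
      (simp add: power2_sum power_mult_distrib algebra_simps)
  also have "\<dots> = expectation (\<lambda>x. (g x)\<^sup>2) + 2 * t * expectation (\<lambda>x. g x * h x)
      + t\<^sup>2 * expectation (\<lambda>x. (h x)\<^sup>2)"
    using g' h' gh by simp
  finally have "expectation (\<lambda>x. (g x + t * h x)\<^sup>2) = \<dots>" .
  moreover have "expectation (\<lambda>x. g x + t * h x) = expectation g"
    using g' h' h0 by simp
  ultimately show ?thesis
    using variance_eq[OF s'(3,2)] variance_eq[OF g'(3,2)] by simp
qed

text \<open>
  If \<open>g\<close> has minimal variance, then \<open>t = 0\<close> minimises the variance of \<open>g + t h\<close>, a quadratic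
  polynomial in \<open>t\<close> whose linear coefficient is the inner product of \<open>g\<close> and \<open>h\<close>.
  Conversely a competitor of \<open>g\<close> differs from it by an unbiased estimator of zero,
  and Pythagoras applies.
\<close>

lemma UMVUE_iff_orthogonal:
  assumes model: "statistical_model A \<Theta> P" and g: "L2_statistic A \<Theta> P g"
  shows "UMVUE A \<Theta> P g \<longleftrightarrow>
    (\<forall>h. unbiased_zero A \<Theta> P h \<longrightarrow> (\<forall>\<theta>\<in>\<Theta>. (\<integral>x. g x * h x \<partial>P \<theta>) = 0))"
proof (intro iffI allI impI ballI)
  fix h \<theta> assume U: "UMVUE A \<Theta> P g" and h: "unbiased_zero A \<Theta> P h" and \<theta>: "\<theta> \<in> \<Theta>"
  have hL: "L2_statistic A \<Theta> P h"
    using h by (simp add: unbiased_zero_def)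
  show "(\<integral>x. g x * h x \<partial>P \<theta>) = 0"
  proof (rule quadratic_nonneg_imp_linear_coeff_zero)
    fix t
    have "L2_statistic A \<Theta> P (\<lambda>x. g x + t * h x)"
      by (rule L2_statistic_add_scaled[OF model g hL])
    moreover have "integral\<^sup>L (P \<eta>) (\<lambda>x. g x + t * h x) = integral\<^sup>L (P \<eta>) g" if "\<eta> \<in> \<Theta>" for \<eta>
      using L2_statisticD[OF model g that] L2_statisticD[OF model hL that] h that
      by (simp add: unbiased_zero_def)
    ultimately have "prob_space.variance (P \<theta>) g \<le> prob_space.variance (P \<theta>) (\<lambda>x. g x + t * h x)"
      using U \<theta> unfolding UMVUE_def by blast
    then show "0 \<le> 2 * t * (\<integral>x. g x * h x \<partial>P \<theta>) + t\<^sup>2 * (\<integral>x. (h x)\<^sup>2 \<partial>P \<theta>)"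
      unfolding variance_add_scaled_unbiased_zero[OF model g h \<theta>] by simp
  qed
next
  assume orth: "\<forall>h. unbiased_zero A \<Theta> P h \<longrightarrow> (\<forall>\<theta>\<in>\<Theta>. (\<integral>x. g x * h x \<partial>P \<theta>) = 0)"
  show "UMVUE A \<Theta> P g"
    unfolding UMVUE_def
  proof (intro conjI allI impI ballI g)
    fix k \<theta>
    assume k: "L2_statistic A \<Theta> P k \<and> (\<forall>\<theta>\<in>\<Theta>. integral\<^sup>L (P \<theta>) k = integral\<^sup>L (P \<theta>) g)"
      and \<theta>: "\<theta> \<in> \<Theta>"
    define h where "h = (\<lambda>x. k x - g x)"
    have "L2_statistic A \<Theta> P h"
      using L2_statistic_add_scaled[OF model k[THEN conjunct1] g, of "- 1"] by (simp add: h_def)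
    moreover have "integral\<^sup>L (P \<eta>) h = 0" if "\<eta> \<in> \<Theta>" for \<eta>
      using L2_statisticD[OF model g that] L2_statisticD[OF model k[THEN conjunct1] that] k that
      by (simp add: h_def)
    ultimately have h: "unbiased_zero A \<Theta> P h"
      by (simp add: unbiased_zero_def)
    have "prob_space.variance (P \<theta>) k = prob_space.variance (P \<theta>) (\<lambda>x. g x + 1 * h x)"
      by (simp add: h_def)
    also have "\<dots> = prob_space.variance (P \<theta>) g + (\<integral>x. (h x)\<^sup>2 \<partial>P \<theta>)"
      using orth h \<theta> by (subst variance_add_scaled_unbiased_zero[OF model g h \<theta>]) simp
    finally show "prob_space.variance (P \<theta>) g \<le> prob_space.variance (P \<theta>) k"
      by simp
  qed
qed

section \<open>The MVE property as a condition on sets\<close>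

text \<open>
  For the implication from right to left, the condition on sets says that the conditional
  expectation of \<open>h\<close> given \<open>F\<close> vanishes, so that \<open>h\<close> is orthogonal to everything
  \<open>F\<close>-measurable with finite second moment.
\<close>

lemma MVE_algebra_iff_integral_zero:
  assumes model: "statistical_model A \<Theta> P"
  shows "MVE_algebra A \<Theta> P F \<longleftrightarrow> subalgebra A F \<and>
    (\<forall>h. unbiased_zero A \<Theta> P h \<longrightarrow> (\<forall>B\<in>sets F. \<forall>\<theta>\<in>\<Theta>. (\<integral>x. indicator B x * h x \<partial>P \<theta>) = 0))"
    (is "_ \<longleftrightarrow> _ \<and> ?zero")
proof
  assume MVE: "MVE_algebra A \<Theta> P F"
  then have sub: "subalgebra A F"
    by (simp add: MVE_algebra_def)
  have ?zero
  proof (intro allI impI ballI)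
    fix h B \<theta> assume h: "unbiased_zero A \<Theta> P h" and B: "B \<in> sets F" and \<theta>: "\<theta> \<in> \<Theta>"
    have BL: "L2_statistic A \<Theta> P (indicator B)"
      using sub B by (intro L2_statistic_indicator[OF model]) (auto simp: subalgebra_def)
    then have "UMVUE A \<Theta> P (indicator B)"
      using MVE B by (auto simp: MVE_algebra_def)
    then show "(\<integral>x. indicator B x * h x \<partial>P \<theta>) = 0"
      using UMVUE_iff_orthogonal[OF model BL] h \<theta> by blast
  qed
  with sub show "subalgebra A F \<and> ?zero" ..
next
  assume *: "subalgebra A F \<and> ?zero"
  show "MVE_algebra A \<Theta> P F"
    unfolding MVE_algebra_def
  proof (intro conjI allI impI)
    show "subalgebra A F" using * ..
    fix g assume g: "g \<in> borel_measurable F \<and> L2_statistic A \<Theta> P g"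
    then have gF: "g \<in> borel_measurable F" and gL: "L2_statistic A \<Theta> P g" by auto
    show "UMVUE A \<Theta> P g"
      unfolding UMVUE_iff_orthogonal[OF model gL]
    proof (intro allI impI ballI)
      fix h \<theta> assume h: "unbiased_zero A \<Theta> P h" and \<theta>: "\<theta> \<in> \<Theta>"
      interpret prob_space "P \<theta>"
        using model \<theta> by (auto simp: statistical_model_def)
      have sets: "sets (P \<theta>) = sets A"
        using model \<theta> by (auto simp: statistical_model_def)
      have "subalgebra (P \<theta>) F"
        using * sets sets_eq_imp_space_eq[OF sets] by (simp add: subalgebra_def)
      then interpret finite_measure_subalgebra "P \<theta>" F
        by unfold_locales
      have hL: "L2_statistic A \<Theta> P h"
        using h by (simp add: unbiased_zero_def)
      note g' = L2_statisticD[OF model gL \<theta>] and h' = L2_statisticD[OF model hL \<theta>]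
      have gh: "integrable (P \<theta>) (\<lambda>x. g x * h x)"
        using g' h' by (intro integrable_mult_of_square_integrable) auto
      have "(\<integral>x\<in>B. h x \<partial>P \<theta>) = (\<integral>x\<in>B. 0 \<partial>P \<theta>)" if "B \<in> sets F" for B
        using * h that \<theta> by (simp add: set_lebesgue_integral_def)
      then have "AE x in P \<theta>. real_cond_exp (P \<theta>) F h x = 0"
        using h'(3) by (intro real_cond_exp_charact) auto
      then have "(\<integral>x. g x * real_cond_exp (P \<theta>) F h x \<partial>P \<theta>) = 0"
        by (intro integral_eq_zero_AE) auto
      then show "(\<integral>x. g x * h x \<partial>P \<theta>) = 0"
        using real_cond_exp_intg(2)[OF gh gF h'(1)] by simp
    qed
  qed
qed

lemma unbiased_zero_times_indicator:
  assumes model: "statistical_model A \<Theta> P" and MVE: "MVE_algebra A \<Theta> P F"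
    and h: "unbiased_zero A \<Theta> P h" and B: "B \<in> sets F"
  shows "unbiased_zero A \<Theta> P (\<lambda>x. indicator B x * h x)"
proof -
  have "B \<in> sets A"
    using MVE B by (auto simp: MVE_algebra_def subalgebra_def)
  then show ?thesis
    using h B L2_statistic_indicator_mult[OF model, of B h] MVE[unfolded MVE_algebra_iff_integral_zero[OF model]]
    by (auto simp: unbiased_zero_def)
qed

text \<open>The sets over which the integral vanishes form a Dynkin system.\<close>

lemma integral_zero_from_rectangles:
  fixes h :: "'a \<times> 'b \<Rightarrow> real"
  assumes h: "integrable M h" and sub: "subalgebra M (F1 \<Otimes>\<^sub>M F2)"
    and rect: "\<And>B1 B2. B1 \<in> sets F1 \<Longrightarrow> B2 \<in> sets F2 \<Longrightarrow>
      (\<integral>x. indicator (B1 \<times> B2) x * h x \<partial>M) = 0"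
    and B: "B \<in> sets (F1 \<Otimes>\<^sub>M F2)"
  shows "(\<integral>x. indicator B x * h x \<partial>M) = 0"
proof -
  let ?\<Omega> = "space F1 \<times> space F2"
  have space: "space M = ?\<Omega>"
    using sub by (simp add: subalgebra_def space_pair_measure)
  have meas: "C \<in> sets M" if "C \<in> sigma_sets ?\<Omega> {a \<times> b |a b. a \<in> sets F1 \<and> b \<in> sets F2}" for C
    using that sub by (auto simp: subalgebra_def sets_pair_measure)
  have int: "integrable M (\<lambda>x. indicator C x * h x)" if "C \<in> sets M" for C
    using integrable_mult_indicator[OF that h] by simp
  show ?thesis
    using Int_stable_pair_measure_generator pair_measure_closed B[unfolded sets_pair_measure]
  proof (induction rule: sigma_sets_induct_disjoint)
    case (basic C)
    then show ?case using rect by auto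
  next
    case empty
    then show ?case by simp
  next
    case (compl C)
    have "(\<integral>x. indicator (?\<Omega> - C) x * h x \<partial>M)
        = (\<integral>x. indicator ?\<Omega> x * h x - indicator C x * h x \<partial>M)"
      using sets.sets_into_space[OF meas[OF compl(1)]]
      by (intro Bochner_Integration.integral_cong) (auto simp: space indicator_def)
    also have "\<dots> = 0"
      using compl rect[of "space F1" "space F2"] int[of ?\<Omega>] int[OF meas[OF compl(1)]]
      by (simp add: space[symmetric])
    finally show ?case .
  next
    case (union C)
    have C: "C i \<in> sets M" for i
      using union(2) meas by blast
    have "(LINT x:(\<Union>i. C i)|M. h x) = (\<Sum>i. (LINT x:(C i)|M. h x))"
      using union(1) C int[of "\<Union>i. C i"]
      by (intro lebesgue_integral_countable_add) (auto simp: disjoint_family_on_def set_integrable_def)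
    then show ?case
      using union(3) by (simp add: set_lebesgue_integral_def)
  qed
qed

section \<open>Product models\<close>

text \<open>Jensen's inequality on each section and Fubini bound the second moment of the marginal.\<close>

lemma (in pair_prob_space) square_integrable_marginal:
  fixes h :: "'a \<times> 'b \<Rightarrow> real"
  assumes [measurable]: "h \<in> borel_measurable (M1 \<Otimes>\<^sub>M M2)"
    and h2: "integrable (M1 \<Otimes>\<^sub>M M2) (\<lambda>z. (h z)\<^sup>2)"
  shows "integrable M1 (\<lambda>x. (\<integral>y. h (x, y) \<partial>M2)\<^sup>2)"
proof (rule Bochner_Integration.integrable_bound)
  show "integrable M1 (\<lambda>x. \<integral>y. (h (x, y))\<^sup>2 \<partial>M2)"
    by (rule integrable_fst'[OF h2])
  show "AE x in M1. norm ((\<integral>y. h (x, y) \<partial>M2)\<^sup>2) \<le> norm (\<integral>y. (h (x, y))\<^sup>2 \<partial>M2)"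
    using AE_integrable_fst'[OF h2] AE_space
  proof eventually_elim
    fix x assume sq: "integrable M2 (\<lambda>y. (h (x, y))\<^sup>2)" and x: "x \<in> space M1"
    have "(\<lambda>y. h (x, y)) \<in> borel_measurable M2"
      using x by measurable
    then have "integrable M2 (\<lambda>y. h (x, y))"
      using sq by (rule M2.square_integrable_imp_integrable)
    then have "(\<integral>y. h (x, y) \<partial>M2)\<^sup>2 \<le> (\<integral>y. (h (x, y))\<^sup>2 \<partial>M2)"
      using M2.variance_eq[OF _ sq] M2.variance_positive[of "\<lambda>y. h (x, y)"] by simp
    then show "norm ((\<integral>y. h (x, y) \<partial>M2)\<^sup>2) \<le> norm (\<integral>y. (h (x, y))\<^sup>2 \<partial>M2)"
      by simp
  qed
qed measurable

lemma pair_prob_space_of_models: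
  assumes "statistical_model A1 \<Theta>1 P1" "statistical_model A2 \<Theta>2 P2" "\<theta>1 \<in> \<Theta>1" "\<theta>2 \<in> \<Theta>2"
  shows "pair_prob_space (P1 \<theta>1) (P2 \<theta>2)"
  using assms
  by (auto simp: statistical_model_def pair_prob_space_def pair_sigma_finite_def
      prob_space_imp_sigma_finite)

lemma unbiased_zero_marginal:
  assumes model1: "statistical_model A1 \<Theta>1 P1" and model2: "statistical_model A2 \<Theta>2 P2"
    and h: "unbiased_zero (A1 \<Otimes>\<^sub>M A2) (\<Theta>1 \<times> \<Theta>2) (\<lambda>(\<theta>1, \<theta>2). P1 \<theta>1 \<Otimes>\<^sub>M P2 \<theta>2) h"
    and \<theta>2: "\<theta>2 \<in> \<Theta>2"
  shows "unbiased_zero A1 \<Theta>1 P1 (\<lambda>x. \<integral>y. h (x, y) \<partial>P2 \<theta>2)"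
proof -
  have hL: "L2_statistic (A1 \<Otimes>\<^sub>M A2) (\<Theta>1 \<times> \<Theta>2) (\<lambda>(\<theta>1, \<theta>2). P1 \<theta>1 \<Otimes>\<^sub>M P2 \<theta>2) h"
    using h by (simp add: unbiased_zero_def)
  interpret P2: prob_space "P2 \<theta>2"
    using model2 \<theta>2 by (auto simp: statistical_model_def)
  have sets2 [measurable_cong]: "sets (P2 \<theta>2) = sets A2"
    using model2 \<theta>2 by (auto simp: statistical_model_def)
  have [measurable]: "h \<in> borel_measurable (A1 \<Otimes>\<^sub>M A2)"
    using hL by (simp add: L2_statistic_def)
  have "(\<lambda>x. \<integral>y. h (x, y) \<partial>P2 \<theta>2) \<in> borel_measurable A1"
    by measurable
  moreover have "integrable (P1 \<theta>1) (\<lambda>x. (\<integral>y. h (x, y) \<partial>P2 \<theta>2)\<^sup>2)"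
    and "(\<integral>x. (\<integral>y. h (x, y) \<partial>P2 \<theta>2) \<partial>P1 \<theta>1) = 0" if \<theta>1: "\<theta>1 \<in> \<Theta>1" for \<theta>1
  proof -
    interpret pair_prob_space "P1 \<theta>1" "P2 \<theta>2"
      by (rule pair_prob_space_of_models[OF model1 model2 \<theta>1 \<theta>2])
    note h' = L2_statisticD[OF statistical_model_pair[OF model1 model2] hL,
        of "(\<theta>1, \<theta>2)", simplified, OF conjI, OF \<theta>1 \<theta>2]
    show "integrable (P1 \<theta>1) (\<lambda>x. (\<integral>y. h (x, y) \<partial>P2 \<theta>2)\<^sup>2)"
      by (rule square_integrable_marginal[OF h'(1,2)])
    show "(\<integral>x. (\<integral>y. h (x, y) \<partial>P2 \<theta>2) \<partial>P1 \<theta>1) = 0"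
      using integral_fst'[OF h'(3)] h \<theta>1 \<theta>2 by (auto simp: unbiased_zero_def)
  qed
  ultimately show ?thesis
    by (simp add: unbiased_zero_def L2_statistic_def)
qed

text \<open>
  By Fubini the expectation of the product is that of the indicator of \<open>B\<close> times the marginal
  of \<open>h\<close> under \<open>\<theta>2\<close>, which vanishes by the MVE property of \<open>F1\<close>. That the conclusion holds
  again for all parameters allows the lemma to be applied twice, once in each factor.
\<close>

lemma unbiased_zero_times_cylinder:
  assumes model1: "statistical_model A1 \<Theta>1 P1" and model2: "statistical_model A2 \<Theta>2 P2"
    and MVE1: "MVE_algebra A1 \<Theta>1 P1 F1"
    and h: "unbiased_zero (A1 \<Otimes>\<^sub>M A2) (\<Theta>1 \<times> \<Theta>2) (\<lambda>(\<theta>1, \<theta>2). P1 \<theta>1 \<Otimes>\<^sub>M P2 \<theta>2) h"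
    and B: "B \<in> sets F1"
  shows "unbiased_zero (A1 \<Otimes>\<^sub>M A2) (\<Theta>1 \<times> \<Theta>2) (\<lambda>(\<theta>1, \<theta>2). P1 \<theta>1 \<Otimes>\<^sub>M P2 \<theta>2)
    (\<lambda>z. indicator (B \<times> space A2) z * h z)"
    (is "unbiased_zero ?A ?\<Theta> ?P ?k")
proof -
  note model = statistical_model_pair[OF model1 model2]
  have "B \<times> space A2 \<in> sets ?A"
    using MVE1 B by (auto simp: MVE_algebra_def subalgebra_def)
  then have kL: "L2_statistic ?A ?\<Theta> ?P ?k"
    using h by (intro L2_statistic_indicator_mult[OF model]) (auto simp: unbiased_zero_def)
  have "integral\<^sup>L (P1 \<theta>1 \<Otimes>\<^sub>M P2 \<theta>2) ?k = 0" if \<theta>1: "\<theta>1 \<in> \<Theta>1" and \<theta>2: "\<theta>2 \<in> \<Theta>2" for \<theta>1 \<theta>2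
  proof -
    interpret pair_prob_space "P1 \<theta>1" "P2 \<theta>2"
      by (rule pair_prob_space_of_models[OF model1 model2 \<theta>1 \<theta>2])
    have space2: "space (P2 \<theta>2) = space A2"
      using model2 \<theta>2 by (auto simp: statistical_model_def intro!: sets_eq_imp_space_eq)
    have "integrable (P1 \<theta>1 \<Otimes>\<^sub>M P2 \<theta>2) ?k"
      using L2_statisticD(3)[OF model kL, of "(\<theta>1, \<theta>2)"] \<theta>1 \<theta>2 by simp
    from integral_fst'[OF this]
    have "integral\<^sup>L (P1 \<theta>1 \<Otimes>\<^sub>M P2 \<theta>2) ?k = (\<integral>x. (\<integral>y. ?k (x, y) \<partial>P2 \<theta>2) \<partial>P1 \<theta>1)"
      by simp
    also have "(\<lambda>x. \<integral>y. ?k (x, y) \<partial>P2 \<theta>2) = (\<lambda>x. indicator B x * (\<integral>y. h (x, y) \<partial>P2 \<theta>2))"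
    proof
      fix x
      have "(\<integral>y. ?k (x, y) \<partial>P2 \<theta>2) = (\<integral>y. indicator B x * h (x, y) \<partial>P2 \<theta>2)"
        by (intro Bochner_Integration.integral_cong) (auto simp: space2 indicator_def)
      then show "(\<integral>y. ?k (x, y) \<partial>P2 \<theta>2) = indicator B x * (\<integral>y. h (x, y) \<partial>P2 \<theta>2)"
        by simp
    qed
    also have "(\<integral>x. indicator B x * (\<integral>y. h (x, y) \<partial>P2 \<theta>2) \<partial>P1 \<theta>1) = 0"
      using unbiased_zero_times_indicator[OF model1 MVE1 unbiased_zero_marginal[OF model1 model2 h \<theta>2] B] \<theta>1
      by (simp add: unbiased_zero_def)
    finally show ?thesis .
  qed
  with kL show ?thesis
    by (auto simp: unbiased_zero_def)
qed

lemma unbiased_zero_swap: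
  assumes model1: "statistical_model A1 \<Theta>1 P1" and model2: "statistical_model A2 \<Theta>2 P2"
    and h: "unbiased_zero (A1 \<Otimes>\<^sub>M A2) (\<Theta>1 \<times> \<Theta>2) (\<lambda>(\<theta>1, \<theta>2). P1 \<theta>1 \<Otimes>\<^sub>M P2 \<theta>2) h"
  shows "unbiased_zero (A2 \<Otimes>\<^sub>M A1) (\<Theta>2 \<times> \<Theta>1) (\<lambda>(\<theta>2, \<theta>1). P2 \<theta>2 \<Otimes>\<^sub>M P1 \<theta>1) (\<lambda>(y, x). h (x, y))"
proof -
  have hL: "L2_statistic (A1 \<Otimes>\<^sub>M A2) (\<Theta>1 \<times> \<Theta>2) (\<lambda>(\<theta>1, \<theta>2). P1 \<theta>1 \<Otimes>\<^sub>M P2 \<theta>2) h"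
    using h by (simp add: unbiased_zero_def)
  have [measurable]: "h \<in> borel_measurable (A1 \<Otimes>\<^sub>M A2)"
    using hL by (simp add: L2_statistic_def)
  have "(\<lambda>(y, x). h (x, y)) \<in> borel_measurable (A2 \<Otimes>\<^sub>M A1)"
    by measurable
  moreover have "integrable (P2 \<theta>2 \<Otimes>\<^sub>M P1 \<theta>1) (\<lambda>(y, x). (h (x, y))\<^sup>2)"
    and "(\<integral>(y, x). h (x, y) \<partial>(P2 \<theta>2 \<Otimes>\<^sub>M P1 \<theta>1)) = 0"
    if \<theta>1: "\<theta>1 \<in> \<Theta>1" and \<theta>2: "\<theta>2 \<in> \<Theta>2" for \<theta>1 \<theta>2
  proof -
    interpret pair_prob_space "P1 \<theta>1" "P2 \<theta>2"
      by (rule pair_prob_space_of_models[OF model1 model2 \<theta>1 \<theta>2])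
    note h' = L2_statisticD[OF statistical_model_pair[OF model1 model2] hL,
        of "(\<theta>1, \<theta>2)", simplified, OF conjI, OF \<theta>1 \<theta>2]
    show "integrable (P2 \<theta>2 \<Otimes>\<^sub>M P1 \<theta>1) (\<lambda>(y, x). (h (x, y))\<^sup>2)"
      by (rule integrable_product_swap[OF h'(2)])
    show "(\<integral>(y, x). h (x, y) \<partial>(P2 \<theta>2 \<Otimes>\<^sub>M P1 \<theta>1)) = 0"
      using integral_product_swap[OF h'(1)] h \<theta>1 \<theta>2 by (auto simp: unbiased_zero_def)
  qed
  ultimately show ?thesis
    by (auto simp: unbiased_zero_def L2_statistic_def case_prod_beta')
qed

lemma subalgebra_pair:
  assumes "subalgebra A1 F1" "subalgebra A2 F2"
  shows "subalgebra (A1 \<Otimes>\<^sub>M A2) (F1 \<Otimes>\<^sub>M F2)"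
proof -
  have "sets (F1 \<Otimes>\<^sub>M F2) \<subseteq> sets (A1 \<Otimes>\<^sub>M A2)"
    unfolding sets_pair_measure[of F1 F2]
    using assms by (intro sets.sigma_sets_subset') (auto simp: subalgebra_def)
  then show ?thesis
    using assms by (simp add: subalgebra_def space_pair_measure)
qed

theorem theorem2:
  fixes A1 F1 :: "'x1 measure" and A2 F2 :: "'x2 measure"
    and \<Theta>1 :: "'t1 set" and \<Theta>2 :: "'t2 set"
    and P1 :: "'t1 \<Rightarrow> 'x1 measure" and P2 :: "'t2 \<Rightarrow> 'x2 measure"
  assumes "statistical_model A1 \<Theta>1 P1"
    and "statistical_model A2 \<Theta>2 P2"
    and "MVE_algebra A1 \<Theta>1 P1 F1"
    and "MVE_algebra A2 \<Theta>2 P2 F2"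
  shows "MVE_algebra (A1 \<Otimes>\<^sub>M A2) (\<Theta>1 \<times> \<Theta>2) (\<lambda>(\<theta>1, \<theta>2). P1 \<theta>1 \<Otimes>\<^sub>M P2 \<theta>2) (F1 \<Otimes>\<^sub>M F2)"
    (is "MVE_algebra ?A ?\<Theta> ?P ?F")
proof -
  note model = statistical_model_pair[OF assms(1,2)]
  have sub1: "subalgebra A1 F1" and sub2: "subalgebra A2 F2"
    using assms(3,4) by (simp_all add: MVE_algebra_def)
  have sub: "subalgebra ?A ?F"
    by (rule subalgebra_pair[OF sub1 sub2])
  moreover have "(\<integral>z. indicator B z * h z \<partial>?P \<theta>) = 0"
    if h: "unbiased_zero ?A ?\<Theta> ?P h" and B: "B \<in> sets ?F" and \<theta>: "\<theta> \<in> ?\<Theta>" for h B \<theta>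
  proof (rule integral_zero_from_rectangles[OF _ _ _ B])
    show "integrable (?P \<theta>) h"
      using h by (intro L2_statisticD(3)[OF model _ \<theta>]) (simp add: unbiased_zero_def)
    have sets: "sets (?P \<theta>) = sets ?A"
      using model \<theta> unfolding statistical_model_def by blast
    then show "subalgebra (?P \<theta>) ?F"
      using sub sets_eq_imp_space_eq[OF sets] by (simp add: subalgebra_def)
    fix B1 B2 assume B1: "B1 \<in> sets F1" and B2: "B2 \<in> sets F2"
    define k where "k = (\<lambda>z. indicator (B1 \<times> space A2) z * h z)"
    have k: "unbiased_zero ?A ?\<Theta> ?P k"
      unfolding k_def by (rule unbiased_zero_times_cylinder[OF assms(1-3) h B1])
    \<comment> \<open>The second cylinder is handled in the model with the factors exchanged.\<close>
    define l where "l = (\<lambda>w. indicator (B2 \<times> space A1) w * (case w of (y, x) \<Rightarrow> k (x, y)))"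
    have l: "unbiased_zero (A2 \<Otimes>\<^sub>M A1) (\<Theta>2 \<times> \<Theta>1) (\<lambda>(\<theta>2, \<theta>1). P2 \<theta>2 \<Otimes>\<^sub>M P1 \<theta>1) l"
      unfolding l_def
      by (rule unbiased_zero_times_cylinder[OF assms(2,1,4) unbiased_zero_swap[OF assms(1,2) k] B2])
    have "B1 \<subseteq> space A1" "B2 \<subseteq> space A2"
      using sets.sets_into_space[OF B1] sets.sets_into_space[OF B2] sub1 sub2
      by (auto simp: subalgebra_def)
    then have "(\<lambda>(x, y). l (y, x)) = (\<lambda>z. indicator (B1 \<times> B2) z * h z)"
      by (auto simp: fun_eq_iff l_def k_def indicator_def)
    then have "unbiased_zero ?A ?\<Theta> ?P (\<lambda>z. indicator (B1 \<times> B2) z * h z)"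
      using unbiased_zero_swap[OF assms(2,1) l] by simp
    then show "(\<integral>z. indicator (B1 \<times> B2) z * h z \<partial>?P \<theta>) = 0"
      using \<theta> unfolding unbiased_zero_def by blast
  qed
  ultimately show ?thesis
    unfolding MVE_algebra_iff_integral_zero[OF model] by blast
qed

end
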